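(* Let $m \geq 1$ and $0 \leq i \leq m$. Let $x$ be an irrational number with infinite continued fraction $[a_1,a_2,a_3,\dots]$ ($a_k$ positive integers), and let $x_n = [a_1,\dots,a_n]$ be its rational convergents. Expand each rational function $r^q_{i,m}(x_n)$ as a power series in $q$. Then: (a) if $n$ is even, the power series of $r^q_{i,m}(x_n)$ and $r^q_{i,m}(x_{n-1})$ agree up to the $q^{a_1+a_2+\cdots+a_n-1}$ term (their difference has no terms of degree less than $a_1+\cdots+a_n-1$); (b) if $n$ is odd, the power series of $r^q_{i,m}(x_n)$ and $r^q_{i,m}(x_{n-1})$ agree up to the $q^{a_1+a_2+\cdots+a_{n-1}-1}$ term (their difference has no terms of degree less than $a_1+\cdots+a_{n-1}-1$).
   Context: Border strip: for positive integers $a_1,\dots,a_n$, $\mathcal{G}[a_1,\dots,a_n]$ consists of unit boxes $b_1,\dots,b_N$, $N=a_1+\cdots+a_n-1$. If $n=1$ it is a vertical column of $a_1-1$ boxes indexed bottom to top. If $n\ge 2$, each $b_{t+1}$ is directly above or directly right of $b_t$, with step sequence: $a_1-1$ up, $a_2$ right, $a_3$ up, $a_4$ right, ..., alternating, ending with $a_n-1$ steps (right if $n$ even, up if $n$ odd). A $P$-partition with parts at most $m$ is a map $\sigma$ from boxes to $\{0,\dots,m\}$ weakly increasing along rows left to right and along columns top to bottom; its weight is the sum of its values. For $1\le i,j\le m+1$, $\Omega_m^{ij}(\mathcal{G},q) = \sum_\sigma q^{\mathrm{wt}(\sigma)}$ over such $\sigma$ with $\sigma(b_1)\le m+1-i$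 and $\sigma(b_N) \le m+1-j$. Higher $q$-continued fractions: for a rational $x \geq 1$ with continued fraction $x=[a_1,\dots,a_n]$ (positive integer entries; the shape $\mathcal{G}(x)=\mathcal{G}[a_1,\dots,a_n]$ does not depend on the choice of continued fraction expansion) and $0 \le i \le m$, \[ r^q_{i,m}(x) := \frac{\Omega_m^{m+1-i,1}(\mathcal{G}(x),q)}{\Omega_m^{m+1,1}(\mathcal{G}(x),q)}. \] (The denominator equals the generating function of $P$-partitions of the strip obtained by deleting the first column, and has constant term $1$; for $x = n$ an integer, $r^q_{i,m}(n) = \binom{n+i-1}{i}_q$.) *)

theory Defs
  imports
    Complex_Main
    "HOL-Library.FuncSet"
    "HOL-Computational_Algebra.Computational_Algebra"
    "HOL-Computational_Algebra.Field_as_Ring"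
begin

fun cfrac_val :: "nat list \<Rightarrow> rat" where
  "cfrac_val [] = 0"
| "cfrac_val [a] = of_nat a"
| "cfrac_val (a # b # as) = of_nat a + 1 / cfrac_val (b # as)"

definition is_cfrac :: "nat list \<Rightarrow> rat \<Rightarrow> bool" where
  "is_cfrac as x \<longleftrightarrow> as \<noteq> [] \<and> (\<forall>a\<in>set as. a > 0) \<and> cfrac_val as = x"

definition cfrac_convergent :: "(nat \<Rightarrow> nat) \<Rightarrow> nat \<Rightarrow> rat" where
  "cfrac_convergent a n = cfrac_val (map a [1..<n + 1])"

text \<open>Boxes are given by their lower-left corner \<open>(column, height)\<close>, with heights growing upwards.\<close>

type_synonym box = "nat \<times> nat"

datatype step = Up | Rgt

fun move :: "step \<Rightarrow> box \<Rightarrow> box" where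
  "move Up (c, h) = (c, Suc h)"
| "move Rgt (c, h) = (Suc c, h)"

fun walk :: "box \<Rightarrow> step list \<Rightarrow> box list" where
  "walk b [] = [b]"
| "walk b (s # ss) = b # walk (move s b) ss"

text \<open>Only for length at least 2: block \<open>k\<close> (counted from 0) consists of \<open>as ! k\<close> steps,
  with one step fewer in the first and in the last block.\<close>

definition strip_steps :: "nat list \<Rightarrow> step list" where
  "strip_steps as = concat (map (\<lambda>k.
     replicate (as ! k - of_bool (k = 0) - of_bool (k = length as - 1))
       (if even k then Up else Rgt)) [0..<length as])"

text \<open>The list \<open>[b_1, \<dots>, b_N]\<close> of boxes of the border strip; it is empty exactly for \<open>[1]\<close>
  among the nonempty lists of positive integers.\<close>

definition border_strip :: "nat list \<Rightarrow> box list" where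
  "border_strip as =
     (if length as = 1 then map (\<lambda>h. (0, h)) [0..<hd as - 1]
      else walk (0, 0) (strip_steps as))"

definition P_partitions :: "nat \<Rightarrow> box set \<Rightarrow> (box \<Rightarrow> nat) set" where
  "P_partitions m B = {\<sigma> \<in> B \<rightarrow>\<^sub>E {0..m}.
     (\<forall>c c' h. (c, h) \<in> B \<and> (c', h) \<in> B \<and> c \<le> c' \<longrightarrow> \<sigma> (c, h) \<le> \<sigma> (c', h)) \<and>
     (\<forall>c h h'. (c, h) \<in> B \<and> (c, h') \<in> B \<and> h' \<le> h \<longrightarrow> \<sigma> (c, h) \<le> \<sigma> (c, h'))}"

text \<open>For the empty strip the two end conditions are vacuous, so the value is 1.\<close>

definition Omega :: "nat \<Rightarrow> nat \<Rightarrow> nat \<Rightarrow> box list \<Rightarrow> rat poly" where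
  "Omega m i j G =
     (\<Sum>\<sigma> | \<sigma> \<in> P_partitions m (set G) \<and>
             (G \<noteq> [] \<longrightarrow> \<sigma> (hd G) \<le> m + 1 - i \<and> \<sigma> (last G) \<le> m + 1 - j).
        monom 1 (\<Sum>b\<in>set G. \<sigma> b))"

text \<open>The choice of the expansion is immaterial, see \<open>strip_of_eq\<close> below.\<close>

definition strip_of :: "rat \<Rightarrow> box list" where
  "strip_of x = border_strip (SOME as. is_cfrac as x)"

definition higher_q_rat :: "nat \<Rightarrow> nat \<Rightarrow> rat \<Rightarrow> rat poly fract" where
  "higher_q_rat i m x =
     Fract (Omega m (m + 1 - i) 1 (strip_of x)) (Omega m (m + 1) 1 (strip_of x))"

text \<open>Power series expansion at \<open>q = 0\<close> of a rational function that is regular there: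
  numerator and denominator in lowest terms are divided as power series.\<close>

definition ratfun_fps :: "rat poly fract \<Rightarrow> rat fps" where
  "ratfun_fps f = fps_of_poly (fst (quot_of_fract f)) / fps_of_poly (snd (quot_of_fract f))"


lemma cfrac_val_ge_1:
  assumes "as \<noteq> []" "\<forall>a\<in>set as. a > 0"
  shows "cfrac_val as \<ge> 1"
  using assms
proof (induction as rule: cfrac_val.induct)
  case (3 a b as)
  then have "cfrac_val (b # as) \<ge> 1" "of_nat a \<ge> (1::rat)"
    by auto
  then have "1 / cfrac_val (b # as) \<ge> 0"
    by simp
  with \<open>of_nat a \<ge> (1::rat)\<close> show ?case
    unfolding cfrac_val.simps by linarith
qed auto

lemma cfrac_val_Cons:
  assumes "as \<noteq> []" "\<forall>a\<in>set as. a > 0"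
  obtains t where "cfrac_val (a # as) = of_nat a + t" "t = 1 / cfrac_val as" "0 < t" "t \<le> 1"
proof -
  have "cfrac_val as \<ge> 1"
    using assms by (rule cfrac_val_ge_1)
  moreover have "cfrac_val (a # as) = of_nat a + 1 / cfrac_val as"
    using assms(1) by (cases as) auto
  ultimately show ?thesis
    using that by simp
qed

lemma cfrac_val_eq_1:
  assumes "as \<noteq> []" "\<forall>a\<in>set as. a > 0" "cfrac_val as = 1"
  shows "as = [1]"
proof -
  obtain a bs where as: "as = a # bs"
    using assms(1) by (cases as) auto
  show ?thesis
  proof (cases "bs = []")
    case True
    with as assms show ?thesis by simp
  next
    case False
    with assms as obtain t where "cfrac_val as = of_nat a + t" "0 < t"
      using cfrac_val_Cons[of bs a] by auto
    moreover have "of_nat a \<ge> (1::rat)"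
      using assms as by (simp add: Suc_leI)
    ultimately show ?thesis
      using assms(3) by linarith
  qed
qed

lemma cfrac_val_singleton:
  assumes "bs \<noteq> []" "\<forall>b\<in>set bs. b > 0" "of_nat a = cfrac_val (b # bs)"
  shows "a = b + 1 \<and> bs = [1]"
proof -
  obtain t where t: "cfrac_val (b # bs) = of_nat b + t" "t = 1 / cfrac_val bs" "0 < t" "t \<le> 1"
    using cfrac_val_Cons[OF assms(1,2)] .
  have "(of_nat b :: rat) < of_nat a" "(of_nat a :: rat) \<le> of_nat (b + 1)"
    using t assms(3) by auto
  then have a: "a = b + 1"
    unfolding of_nat_less_iff of_nat_le_iff by simp
  then have "t = 1"
    using t(1) assms(3) by simp
  then have "cfrac_val bs = 1"
    using t(2) by (simp add: divide_eq_1_iff)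
  then show ?thesis
    using a cfrac_val_eq_1[OF assms(1,2)] by simp
qed

lemma cfrac_val_unique:
  assumes "as \<noteq> []" "\<forall>a\<in>set as. a > 0" "bs \<noteq> []" "\<forall>b\<in>set bs. b > 0"
    and "cfrac_val as = cfrac_val bs"
  shows "as = bs \<or> (\<exists>xs a. as = xs @ [a, 1] \<and> bs = xs @ [a + 1])
           \<or> (\<exists>xs a. bs = xs @ [a, 1] \<and> as = xs @ [a + 1])"
  using assms
proof (induction as arbitrary: bs)
  case (Cons a as)
  obtain b bs' where bs: "bs = b # bs'"
    using Cons.prems by (cases bs) auto
  consider "as = []" "bs' = []" | "as = []" "bs' \<noteq> []" | "as \<noteq> []" "bs' = []"
    | "as \<noteq> []" "bs' \<noteq> []"
    by blast
  then show ?case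
  proof cases
    case 1
    then show ?thesis using bs Cons.prems by simp
  next
    case 2
    then have "a = b + 1 \<and> bs' = [1]"
      using cfrac_val_singleton[of bs' a b] Cons.prems bs by simp
    then have "bs = [] @ [b, 1] \<and> a # as = [] @ [b + 1]"
      using bs 2 by simp
    then show ?thesis by blast
  next
    case 3
    then have "b = a + 1 \<and> as = [1]"
      using cfrac_val_singleton[of as b a] Cons.prems bs by simp
    then have "a # as = [] @ [a, 1] \<and> bs = [] @ [a + 1]"
      using bs 3 by simp
    then show ?thesis by blast
  next
    case 4
    obtain s where s: "cfrac_val (a # as) = of_nat a + s" "s = 1 / cfrac_val as" "0 < s" "s \<le> 1"
      using cfrac_val_Cons[of as a] 4 Cons.prems by auto
    obtain t where t: "cfrac_val (b # bs') = of_nat b + t" "t = 1 / cfrac_val bs'" "0 < t" "t \<le> 1"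
      using cfrac_val_Cons[of bs' b] 4 Cons.prems bs by auto
    have eq: "of_nat a + s = of_nat b + t"
      using s t Cons.prems bs by simp
    then have "of_nat a < of_nat b + (1::rat)" "of_nat b < of_nat a + (1::rat)"
      using s(3,4) t(3,4) by linarith+
    then have "(of_nat a :: rat) < of_nat (b + 1)" "(of_nat b :: rat) < of_nat (a + 1)"
      by simp_all
    then have ab: "a = b"
      unfolding of_nat_less_iff by simp
    then have "cfrac_val as = cfrac_val bs'"
      using eq s(2) t(2) by simp
    then have "as = bs' \<or> (\<exists>xs a. as = xs @ [a, 1] \<and> bs' = xs @ [a + 1])
           \<or> (\<exists>xs a. bs' = xs @ [a, 1] \<and> as = xs @ [a + 1])"
      using Cons.IH[of bs'] 4 Cons.prems bs by simp
    then show ?thesis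
      unfolding bs ab by (metis append_Cons)
  qed
qed simp

lemma walk_replicate_Up:
  "walk (c, h) (replicate n Up) = map (\<lambda>k. (c, k)) [h..<h + Suc n]"
proof (induction n arbitrary: h)
  case (Suc n)
  have "[h..<h + Suc (Suc n)] = h # [Suc h..<Suc h + Suc n]"
    by (subst upt_conv_Cons) auto
  then show ?case
    using Suc[of "Suc h"] by simp
qed simp

lemma border_strip_append_1:
  assumes "a > 0"
  shows "border_strip (xs @ [a, 1]) = border_strip (xs @ [a + 1])"
proof (cases "xs = []")
  case True
  have "strip_steps [a, 1] = replicate (a - 1) Up"
    by (simp add: strip_steps_def)
  then show ?thesis
    using assms True walk_replicate_Up[of 0 0 "a - 1"] by (simp add: border_strip_def)
next
  case False
  have "strip_steps (xs @ [a, 1]) = strip_steps (xs @ [a + 1])"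
    using False
    by (auto simp: strip_steps_def nth_append intro!: arg_cong[of _ _ concat])
  then show ?thesis
    using False by (simp add: border_strip_def)
qed

lemma strip_of_eq:
  assumes "is_cfrac as x"
  shows "strip_of x = border_strip as"
proof -
  define bs where "bs = (SOME as. is_cfrac as x)"
  have bs: "is_cfrac bs x"
    unfolding bs_def using assms by (rule someI)
  have "as = bs \<or> (\<exists>xs a. as = xs @ [a, 1] \<and> bs = xs @ [a + 1])
           \<or> (\<exists>xs a. bs = xs @ [a, 1] \<and> as = xs @ [a + 1])"
    using assms bs by (intro cfrac_val_unique) (auto simp: is_cfrac_def)
  then have "border_strip bs = border_strip as"
    using assms bs border_strip_append_1 by (fastforce simp: is_cfrac_def)
  then show ?thesis
    by (simp add: strip_of_def bs_def)
qed

lemma ratfun_fps_Fract: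
  assumes "coeff q 0 \<noteq> 0"
  shows "ratfun_fps (Fract p q) = fps_of_poly p / fps_of_poly q"
proof -
  define p' q' where "p' = fst (quot_of_fract (Fract p q))" and "q' = snd (quot_of_fract (Fract p q))"
  have q: "q \<noteq> 0" using assms by auto
  have q': "q' \<noteq> 0" by (simp add: q'_def)
  have "Fract p' q' = Fract p q"
    unfolding p'_def q'_def by simp
  then have eq: "p' * q = p * q'"
    using q q' by (simp add: eq_fract)
  moreover have "coprime p' q'"
    unfolding p'_def q'_def by (simp add: coprime_quot_of_fract)
  ultimately have "q' dvd q"
    by (metis coprime_commute coprime_dvd_mult_right_iff dvd_triv_right)
  then have "coeff q' 0 \<noteq> 0"
    using assms by (auto simp: coeff_mult elim!: dvdE)
  then have inv: "fps_of_poly q' * inverse (fps_of_poly q') = 1"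
    by (intro inverse_mult_eq_1') simp
  have inv': "fps_of_poly q * inverse (fps_of_poly q) = 1"
    using assms by (intro inverse_mult_eq_1') simp
  have mult: "fps_of_poly p' * fps_of_poly q = fps_of_poly p * fps_of_poly q'"
    using eq by (simp flip: fps_of_poly_mult)
  have "fps_of_poly p' * inverse (fps_of_poly q')
        = (fps_of_poly p' * fps_of_poly q) * inverse (fps_of_poly q) * inverse (fps_of_poly q')"
    using inv' by (simp add: mult.assoc)
  also have "\<dots> = fps_of_poly p * inverse (fps_of_poly q)
        * (fps_of_poly q' * inverse (fps_of_poly q'))"
    unfolding mult by (simp only: mult_ac)
  also have "\<dots> = fps_of_poly p * inverse (fps_of_poly q)"
    using inv by simp
  finally have "fps_of_poly p' / fps_of_poly q' = fps_of_poly p / fps_of_poly q"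
    using assms \<open>coeff q' 0 \<noteq> 0\<close> by (simp add: fps_divide_unit)
  then show ?thesis
    by (simp add: ratfun_fps_def p'_def q'_def)
qed

end

theory Submission
  imports Defs
begin

text \<open>The generating function of a strip is computed box by box: prepending a box replaces the
  vector \<open>f\<close>, indexed by the value of the first box, by \<open>q\<^sup>c \<Sum> f d\<close>, where \<open>d\<close> ranges over the values
  \<open>\<le> c\<close> or \<open>\<ge> c\<close> depending on the step. The \<open>2 \<times> 2\<close> minors \<open>u\<^sub>c v\<^sub>d - u\<^sub>d v\<^sub>c\<close> of two vectors thereby
  turn into \<open>q\<^sup>c\<^sup>+\<^sup>d\<close> times sums of such minors, so they gain a factor \<open>q\<close> with every box. The difference
  of two consecutive convergents is a sum of such minors over a product of two series with constant
  term 1. The number of common steps is \<open>a\<^sub>1 + \<dots> + a\<^sub>n\<^sub>-\<^sub>1 - 1\<close>; for even \<open>n\<close> the last block of \<open>a\<^sub>n\<close> steps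
  to the right is common as well, because these fix the end vector of the shorter strip.\<close>

section \<open>Transfer operators\<close>

text \<open>\<open>c\<close> is the value of a box and \<open>d\<close> that of the next one. Values
  grow downwards in a column, so a step up requires \<open>d \<le> c\<close>.\<close>

fun step_rel :: "step \<Rightarrow> nat \<Rightarrow> nat \<Rightarrow> bool" where
  "step_rel Up c d \<longleftrightarrow> d \<le> c"
| "step_rel Rgt c d \<longleftrightarrow> c \<le> d"

text \<open>Entries beyond \<open>m\<close> are set to 0, so that the identities below are
  equalities of functions and not only of values on \<open>{0..m}\<close>.\<close>

definition transfer :: "'a::comm_ring_1 \<Rightarrow> nat \<Rightarrow> step \<Rightarrow> (nat \<Rightarrow> 'a) \<Rightarrow> nat \<Rightarrow> 'a" where
  "transfer q m s f c = (if c \<le> m then q ^ c * (\<Sum>d | d \<le> m \<and> step_rel s c d. f d) else 0)"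

abbreviation transfers :: "'a::comm_ring_1 \<Rightarrow> nat \<Rightarrow> step list \<Rightarrow> (nat \<Rightarrow> 'a) \<Rightarrow> nat \<Rightarrow> 'a" where
  "transfers q m \<equiv> foldr (transfer q m)"

definition box_vec :: "'a::comm_ring_1 \<Rightarrow> nat \<Rightarrow> nat \<Rightarrow> 'a" where
  "box_vec q m c = (if c \<le> m then q ^ c else 0)"

text \<open>A phantom box of value 0 above the last box constrains nothing, so a single box is
  itself a transfer. For a step to the right the value \<open>m\<close> does the same.\<close>

lemma transfer_Up_delta: "transfer q m Up (\<lambda>c. of_bool (c = 0)) = box_vec q m"
proof
  fix c
  have "{d. d \<le> m \<and> d \<le> c} \<inter> {0} = {0::nat}" by auto
  then show "transfer q m Up (\<lambda>c. of_bool (c = 0)) c = box_vec q m c"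
    by (simp add: transfer_def box_vec_def of_bool_def sum.If_cases)
qed

lemma transfer_Rgt_delta: "transfer q m Rgt (\<lambda>c. of_bool (c = m)) = box_vec q m"
proof
  fix c
  have "{d. d \<le> m \<and> c \<le> d} \<inter> {m} = {m}" if "c \<le> m" using that by auto
  then show "transfer q m Rgt (\<lambda>c. of_bool (c = m)) c = box_vec q m c"
    by (simp add: transfer_def box_vec_def of_bool_def sum.If_cases)
qed

text \<open>The relation \<open>c \<le> 0\<close> leaves only \<open>c = 0\<close>, where the weight
  \<open>q ^ c\<close> is 1.\<close>

lemma transfer_Rgt_fixed: "transfer q m Rgt (\<lambda>c. of_bool (c = 0)) = (\<lambda>c. of_bool (c = 0))"
proof
  fix c :: nat
  have "(\<Sum>d | d \<le> m \<and> c \<le> d. of_bool (d = 0)) = (of_bool (c = 0) :: 'a)"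
    by (cases "c = 0") (auto simp: of_bool_def sum.If_cases)
  then show "transfer q m Rgt (\<lambda>c. of_bool (c = 0)) c = of_bool (c = 0)"
    by (simp add: transfer_def)
qed

lemma transfers_replicate_Rgt_fixed:
  "transfers q m (replicate k Rgt) (\<lambda>c. of_bool (c = 0)) = (\<lambda>c. of_bool (c = 0))"
  by (induction k) (simp_all add: transfer_Rgt_fixed)

lemma minor_sum:
  fixes u v :: "nat \<Rightarrow> 'a::comm_ring_1"
  shows "sum u A * sum v B - sum u B * sum v A = (\<Sum>c\<in>A. \<Sum>d\<in>B. u c * v d - u d * v c)"
proof -
  have "sum u B * sum v A = (\<Sum>c\<in>A. \<Sum>d\<in>B. u d * v c)"
    by (subst sum.swap) (simp add: sum_product)
  then show ?thesis
    by (simp add: sum_product sum_subtractf)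
qed

lemma minor_sum_dvd:
  fixes u v :: "nat \<Rightarrow> 'a::comm_ring_1"
  assumes "\<And>c d. c \<in> A \<Longrightarrow> d \<in> B \<Longrightarrow> p dvd u c * v d - u d * v c"
  shows "p dvd sum u A * sum v B - sum u B * sum v A"
  unfolding minor_sum using assms by (intro dvd_sum) auto

text \<open>The weights contribute \<open>q ^ (c + d)\<close>, and bilinearity leaves a sum of
  minors of \<open>u\<close> and \<open>v\<close>. Off the diagonal \<open>c + d > 0\<close>
  supplies the extra factor \<open>q\<close>; on it the minor is 0.\<close>

lemma minor_transfer_dvd:
  assumes "\<And>c d. c \<le> m \<Longrightarrow> d \<le> m \<Longrightarrow> p dvd u c * v d - u d * v c"
    and "c \<le> m" "d \<le> m"
  shows "q * p dvd transfer q m s u c * transfer q m s v d - transfer q m s u d * transfer q m s v c"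
proof (cases "c = d")
  case False
  define A where "A c = {d. d \<le> m \<and> step_rel s c d}" for c
  have "p dvd sum u (A c) * sum v (A d) - sum u (A d) * sum v (A c)"
    using assms(1) by (intro minor_sum_dvd) (auto simp: A_def)
  moreover have "q dvd q ^ (c + d)"
    using False by (intro dvd_power) auto
  moreover have "transfer q m s u c * transfer q m s v d - transfer q m s u d * transfer q m s v c
      = q ^ (c + d) * (sum u (A c) * sum v (A d) - sum u (A d) * sum v (A c))"
    using assms(2,3) by (simp add: transfer_def A_def power_add algebra_simps)
  ultimately show ?thesis
    by (simp only: mult_dvd_mono)
qed simp

lemma minor_transfers_dvd:
  assumes "c \<le> m" "d \<le> m"
  shows "q ^ length ss dvd
    transfers q m ss u c * transfers q m ss v d - transfers q m ss u d * transfers q m ss v c"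
  using assms
proof (induction ss arbitrary: c d)
  case (Cons s ss)
  then show ?case
    using minor_transfer_dvd[of m "q ^ length ss" "transfers q m ss u" "transfers q m ss v" c d q s]
    by simp
qed simp

text \<open>As \<open>q\<close> has no constant term, the weight \<open>q ^ c\<close> kills every
  constant term except at \<open>c = 0\<close>. There the next value 0 is allowed by both steps, so
  the 1 is passed on.\<close>

lemma coeff_0_transfers_box_vec:
  assumes "c \<le> m" "coeff q 0 = 0"
  shows "coeff (transfers q m ss (box_vec q m) c) 0 = of_bool (c = 0)"
  using assms(1)
proof (induction ss arbitrary: c)
  case Nil
  then show ?case
    using assms(2) by (simp add: box_vec_def coeff_0_power power_0_left)
next
  case (Cons s ss)
  have "(\<Sum>d | d \<le> m \<and> step_rel s 0 d. coeff (transfers q m ss (box_vec q m) d) 0)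
      = (\<Sum>d | d \<le> m \<and> step_rel s 0 d. of_bool (d = 0))"
    using Cons.IH by (intro sum.cong) auto
  also have "\<dots> = 1"
  proof -
    have "step_rel s 0 0"
      by (cases s) auto
    then show ?thesis
      by (simp add: of_bool_def sum.If_cases)
  qed
  finally show ?case
    using Cons.prems assms(2) by (auto simp: transfer_def[of q m s] coeff_mult coeff_0_power coeff_sum power_0_left)
qed

section \<open>Generating functions of walks\<close>

text \<open>No step decreases a coordinate. Hence a walk never revisits its start, and after a step
  up (right) it has left the row (column) of the start for good.\<close>

lemma walk_ge: "(c', h') \<in> set (walk (c, h) ss) \<Longrightarrow> c \<le> c' \<and> h \<le> h'"
proof (induction ss arbitrary: c h)
  case (Cons s ss)
  show ?case
    by (cases s) (use Cons.prems Cons.IH in \<open>fastforce+\<close>)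
qed simp

lemma start_in_walk: "b \<in> set (walk b ss)"
  by (cases ss) auto

lemma hd_walk: "hd (walk b ss) = b"
  by (cases ss) auto

lemma walk_neq_Nil [simp]: "walk b ss \<noteq> []"
  by (cases ss) auto

lemma start_notin_walk_move: "b \<notin> set (walk (move s b) ss)"
proof (cases b)
  case (Pair c h)
  then show ?thesis
    by (cases s) (auto dest: walk_ge)
qed

lemma finite_P_partitions: "finite B \<Longrightarrow> finite (P_partitions m B)"
  unfolding P_partitions_def by (rule finite_subset[of _ "B \<rightarrow>\<^sub>E {0..m}"]) (auto intro: finite_PiE)

lemma P_partitionsD:
  assumes "\<sigma> \<in> P_partitions m B"
  shows "\<sigma> \<in> B \<rightarrow>\<^sub>E {0..m}"
    and "\<And>c c' h. (c, h) \<in> B \<Longrightarrow> (c', h) \<in> B \<Longrightarrow> c \<le> c' \<Longrightarrow> \<sigma> (c, h) \<le> \<sigma> (c', h)"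
    and "\<And>c h h'. (c, h) \<in> B \<Longrightarrow> (c, h') \<in> B \<Longrightarrow> h' \<le> h \<Longrightarrow> \<sigma> (c, h) \<le> \<sigma> (c, h')"
  using assms unfolding P_partitions_def by blast+

lemma P_partitions_le: "\<sigma> \<in> P_partitions m B \<Longrightarrow> b \<in> B \<Longrightarrow> \<sigma> b \<le> m"
  by (auto dest!: P_partitionsD(1))

text \<open>Only the next box matters to \<open>b\<close>: after a step up no later box shares its
  row, and later boxes in its column are bounded through the box directly above. Steps to the right
  are symmetric.\<close>

lemma P_partitions_step:
  fixes b :: box and s :: step and ss :: "step list"
  defines "B \<equiv> set (walk (move s b) ss)"
  assumes "k \<le> m"
  shows "{\<sigma> \<in> P_partitions m (insert b B). \<sigma> b = k} =
    (\<lambda>\<tau>. \<tau>(b := k)) ` {\<tau> \<in> P_partitions m B. step_rel s k (\<tau> (move s b))}" (is "?L = ?R")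
proof -
  obtain c h where b: "b = (c, h)" by (cases b)
  have bB: "b \<notin> B"
    unfolding B_def by (rule start_notin_walk_move)
  have mB: "move s b \<in> B"
    unfolding B_def by (rule start_in_walk)
  show ?thesis
  proof (intro equalityI subsetI)
    fix \<sigma> assume "\<sigma> \<in> ?L"
    then have \<sigma>: "\<sigma> \<in> P_partitions m (insert b B)" "\<sigma> b = k" by auto
    note D = P_partitionsD[OF \<sigma>(1)]
    \<comment> \<open>Extensional functions are \<open>undefined\<close> off their domain, so this
      is the restriction to \<open>B\<close>.\<close>
    define \<tau> where "\<tau> = \<sigma>(b := undefined)"
    have \<tau>\<sigma>: "\<tau> x = \<sigma> x" if "x \<in> B" for x
      using that bB by (auto simp: \<tau>_def)
    have "\<tau> \<in> B \<rightarrow>\<^sub>E {0..m}"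
      unfolding \<tau>_def using D(1) bB by (intro fun_upd_in_PiE) auto
    then have "\<tau> \<in> P_partitions m B"
      unfolding P_partitions_def using D(2,3) \<tau>\<sigma> by simp
    moreover have "step_rel s k (\<tau> (move s b))"
      using D(2)[of c h "Suc c"] D(3)[of c "Suc h" h] mB \<tau>\<sigma>[OF mB] \<sigma>(2) b by (cases s) auto
    moreover have "\<sigma> = \<tau>(b := k)"
      using \<sigma>(2) by (auto simp: \<tau>_def)
    ultimately show "\<sigma> \<in> ?R" by blast
  next
    fix \<sigma> assume "\<sigma> \<in> ?R"
    then obtain \<tau> where \<tau>: "\<tau> \<in> P_partitions m B" "step_rel s k (\<tau> (move s b))"
      and \<sigma>: "\<sigma> = \<tau>(b := k)" by auto
    note D = P_partitionsD[OF \<tau>(1)]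
    \<comment> \<open>After a step up the row is empty. The strict inequality excludes pairs with
      \<open>b\<close> as the right-hand box.\<close>
    have row: "k \<le> \<tau> (c', h) \<and> c < c'" if "(c', h) \<in> B" for c'
    proof (cases s)
      case Up
      then show ?thesis using that b by (auto simp: B_def dest: walk_ge)
    next
      case Rgt
      then have "Suc c \<le> c'" using that b by (auto simp: B_def dest: walk_ge)
      then show ?thesis
        using D(2)[of "Suc c" h c'] that mB \<tau>(2) b Rgt by auto
    qed
    have col: "\<tau> (c, h') \<le> k \<and> h < h'" if "(c, h') \<in> B" for h'
    proof (cases s)
      case Rgt
      then show ?thesis using that b by (auto simp: B_def dest: walk_ge)
    next
      case Up
      then have "Suc h \<le> h'" using that b by (auto simp: B_def dest: walk_ge)
      then show ?thesis
        using D(3)[of c h' "Suc h"] that mB \<tau>(2) b Up by auto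
    qed
    have "\<sigma> \<in> insert b B \<rightarrow>\<^sub>E {0..m}"
      unfolding \<sigma> using D(1) assms(2) by (intro PiE_fun_upd) auto
    moreover have "\<sigma> (c1, h1) \<le> \<sigma> (c2, h1)"
      if "(c1, h1) \<in> insert b B" "(c2, h1) \<in> insert b B" "c1 \<le> c2" for c1 c2 h1
      using that D(2)[of c1 h1 c2] row b unfolding \<sigma> by (fastforce dest: row)
    moreover have "\<sigma> (c1, h1) \<le> \<sigma> (c1, h2)"
      if "(c1, h1) \<in> insert b B" "(c1, h2) \<in> insert b B" "h2 \<le> h1" for c1 h1 h2
      using that D(3)[of c1 h1 h2] col b unfolding \<sigma> by (fastforce dest: col)
    ultimately show "\<sigma> \<in> ?L"
      unfolding P_partitions_def by (simp add: \<sigma>)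
  qed
qed

lemma sum_partition_nat:
  assumes "finite A" "\<And>x. x \<in> A \<Longrightarrow> P (f x) \<Longrightarrow> f x \<le> (m::nat)"
  shows "(\<Sum>x | x \<in> A \<and> P (f x). g x) = (\<Sum>d | d \<le> m \<and> P d. \<Sum>x | x \<in> A \<and> f x = d. g x)"
proof -
  have "(\<Sum>x | x \<in> A \<and> P (f x). g x)
      = (\<Sum>d | d \<le> m \<and> P d. \<Sum>x | x \<in> {x \<in> A. P (f x)} \<and> f x = d. g x)"
    using assms by (intro sum.group[symmetric]) auto
  also have "\<dots> = (\<Sum>d | d \<le> m \<and> P d. \<Sum>x | x \<in> A \<and> f x = d. g x)"
    by (intro sum.cong) auto
  finally show ?thesis .
qed

lemma walk_gf:
  fixes b :: box
  defines "q \<equiv> monom 1 1 :: rat poly"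
  shows "(\<Sum>\<sigma> | \<sigma> \<in> P_partitions m (set (walk b ss)) \<and> \<sigma> b = k. q ^ (\<Sum>x\<in>set (walk b ss). \<sigma> x))
    = transfers q m ss (box_vec q m) k"
proof (cases "k \<le> m")
  case False
  \<comment> \<open>Both sides vanish beyond \<open>m\<close>: no P-partition takes such a value,
    and the vectors are cut off there.\<close>
  have none: "{\<sigma>. \<sigma> \<in> P_partitions m (set (walk b ss)) \<and> \<sigma> b = k} = {}"
    using False start_in_walk[of b ss] by (auto dest: P_partitions_le)
  have "transfers q m ss (box_vec q m) k = 0"
    using False by (cases ss) (auto simp: box_vec_def transfer_def)
  then show ?thesis
    unfolding none by simp
next
  case True
  then show ?thesis
  proof (induction ss arbitrary: b k)
    case Nil
    have "{\<sigma>. \<sigma> \<in> P_partitions m {b} \<and> \<sigma> b = k} = {(\<lambda>x. undefined)(b := k)}"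
      using Nil by (auto simp: P_partitions_def PiE_def extensional_def fun_eq_iff)
    then show ?case
      using Nil by (simp add: box_vec_def)
  next
    case (Cons s ss)
    define B where "B = set (walk (move s b) ss)"
    have bB: "b \<notin> B"
      unfolding B_def by (rule start_notin_walk_move)
    have mB: "move s b \<in> B"
      unfolding B_def by (rule start_in_walk)
    have fin: "finite B" by (simp add: B_def)
    have inj: "inj_on (\<lambda>\<tau>. \<tau>(b := k)) {\<tau> \<in> P_partitions m B. step_rel s k (\<tau> (move s b))}"
    proof (rule inj_onI)
      fix \<tau> \<tau>' assume *: "\<tau> \<in> {\<tau> \<in> P_partitions m B. step_rel s k (\<tau> (move s b))}"
        "\<tau>' \<in> {\<tau> \<in> P_partitions m B. step_rel s k (\<tau> (move s b))}" "\<tau>(b := k) = \<tau>'(b := k)"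
      \<comment> \<open>Both functions are \<open>undefined\<close> at \<open>b\<close>, so
        overwriting that value loses no information.\<close>
      have "\<tau> b = \<tau>' b"
        using *(1,2) bB PiE_arb[OF P_partitionsD(1)] by (metis (mono_tags, lifting) mem_Collect_eq)
      with *(3) show "\<tau> = \<tau>'"
        by (metis fun_upd_triv fun_upd_upd)
    qed
    have "(\<Sum>\<sigma> | \<sigma> \<in> P_partitions m (insert b B) \<and> \<sigma> b = k. q ^ (\<Sum>x\<in>insert b B. \<sigma> x))
        = (\<Sum>\<tau> | \<tau> \<in> P_partitions m B \<and> step_rel s k (\<tau> (move s b)).
             q ^ (\<Sum>x\<in>insert b B. (\<tau>(b := k)) x))"
      unfolding B_def P_partitions_step[OF Cons.prems]
      using inj by (simp only: sum.reindex B_def[symmetric] o_def)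
    also have "\<dots> = (\<Sum>\<tau> | \<tau> \<in> P_partitions m B \<and> step_rel s k (\<tau> (move s b)).
             q ^ k * q ^ (\<Sum>x\<in>B. \<tau> x))"
    proof (intro sum.cong refl)
      fix \<tau> :: "box \<Rightarrow> nat"
      have "(\<Sum>x\<in>B. (\<tau>(b := k)) x) = (\<Sum>x\<in>B. \<tau> x)"
        using bB by (intro sum.cong) auto
      then show "q ^ (\<Sum>x\<in>insert b B. (\<tau>(b := k)) x) = q ^ k * q ^ (\<Sum>x\<in>B. \<tau> x)"
        using fin bB by (simp add: power_add)
    qed
    also have "\<dots> = q ^ k * (\<Sum>\<tau> | \<tau> \<in> P_partitions m B \<and> step_rel s k (\<tau> (move s b)).
             q ^ (\<Sum>x\<in>B. \<tau> x))"
      by (simp add: sum_distrib_left)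
    also have "\<dots> = q ^ k * (\<Sum>d | d \<le> m \<and> step_rel s k d.
             \<Sum>\<tau> | \<tau> \<in> P_partitions m B \<and> \<tau> (move s b) = d. q ^ (\<Sum>x\<in>B. \<tau> x))"
      using mB fin
      by (subst sum_partition_nat[where m = m]) (auto intro: finite_P_partitions P_partitions_le)
    also have "\<dots> = q ^ k * (\<Sum>d | d \<le> m \<and> step_rel s k d. transfers q m ss (box_vec q m) d)"
      using Cons.IH by (auto simp: B_def intro!: sum.cong)
    also have "\<dots> = transfers q m (s # ss) (box_vec q m) k"
      using Cons.prems by (simp add: transfer_def)
    finally show ?case
      by (simp add: B_def)
  qed
qed

text \<open>The bound on the last box is \<open>m\<close>, which always holds; the bound on the
  first is \<open>m + 1 - (m + 1 - i) = i\<close>.\<close>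

lemma Omega_walk:
  assumes "i \<le> m"
  shows "Omega m (m + 1 - i) 1 (walk b ss)
    = (\<Sum>k\<le>i. transfers (monom 1 1) m ss (box_vec (monom 1 1) m) k)"
proof -
  define W where "W = set (walk b ss)"
  have fin: "finite W" and bW: "b \<in> W" and lW: "last (walk b ss) \<in> W"
    by (simp_all add: W_def start_in_walk)
  have "Omega m (m + 1 - i) 1 (walk b ss)
      = (\<Sum>\<sigma> | \<sigma> \<in> P_partitions m W \<and> \<sigma> b \<le> i. monom 1 1 ^ (\<Sum>x\<in>W. \<sigma> x))"
    unfolding Omega_def W_def[symmetric]
    using assms lW by (intro sum.cong) (auto simp: hd_walk monom_power P_partitions_le)
  also have "\<dots> = (\<Sum>k | k \<le> m \<and> k \<le> i. \<Sum>\<sigma> | \<sigma> \<in> P_partitions m W \<and> \<sigma> b = k.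
      monom 1 1 ^ (\<Sum>x\<in>W. \<sigma> x))"
    using assms fin by (subst sum_partition_nat[where m = m]) (auto intro: finite_P_partitions)
  also have "{k. k \<le> m \<and> k \<le> i} = {..i}"
    using assms by auto
  finally show ?thesis
    by (simp only: W_def walk_gf)
qed

section \<open>Border strips\<close>

text \<open>For length at least 2 this is \<open>strip_steps\<close> with one more step in the last block, so that there
  are as many steps as boxes. The last box is then produced by the extra step from an end vector
  concentrated at a single value.\<close>

definition strip_blocks :: "nat list \<Rightarrow> step list" where
  "strip_blocks as = concat (map (\<lambda>k. replicate (as ! k - of_bool (k = 0))
     (if even k then Up else Rgt)) [0..<length as])"

definition end_step :: "nat list \<Rightarrow> step" where
  "end_step as = (if odd (length as) then Up else Rgt)"

text \<open>The vector sits at the value for which the inequality of \<open>end_step\<close> is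
  vacuous.\<close>

definition end_vec :: "nat \<Rightarrow> nat list \<Rightarrow> nat \<Rightarrow> 'a::comm_ring_1" where
  "end_vec m as c = of_bool (c = (if odd (length as) then 0 else m))"

text \<open>For a nonempty strip, entry \<open>k\<close> enumerates the P-partitions with value
  \<open>k\<close> at the first box. The empty strip of \<open>[1]\<close> gets the unit vector at
  0, whose partial sums are the required 1.\<close>

definition strip_vec :: "nat \<Rightarrow> nat list \<Rightarrow> nat \<Rightarrow> rat poly" where
  "strip_vec m as = transfers (monom 1 1) m (strip_blocks as) (end_vec m as)"

lemma strip_blocks_snoc:
  assumes "as \<noteq> []"
  shows "strip_blocks (as @ [b]) = strip_blocks as @ replicate b (end_step (as @ [b]))"
  using assms
  by (auto simp: strip_blocks_def end_step_def nth_append intro!: arg_cong[of _ _ concat])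

lemma length_strip_blocks:
  assumes "as \<noteq> []" "\<forall>a\<in>set as. a > 0"
  shows "length (strip_blocks as) = sum_list as - 1"
  using assms
proof (induction as rule: rev_nonempty_induct)
  case (single a)
  show ?case by (simp add: strip_blocks_def)
next
  case (snoc a as)
  have "sum_list as > 0"
    using snoc.hyps snoc.prems by (cases as) auto
  then show ?case
    using snoc by (simp add: strip_blocks_snoc)
qed

lemma border_strip_walk:
  assumes "as \<noteq> []" "\<forall>a\<in>set as. a > 0" "as \<noteq> [1]"
  obtains ss where "border_strip as = walk (0, 0) ss" "strip_blocks as = ss @ [end_step as]"
proof (cases "length as = 1")
  case True
  then obtain a where as: "as = [a]" by (auto simp: length_Suc_conv)
  with assms have "a > 1" by (auto simp: Suc_lessI)
  \<comment> \<open>A column of \<open>a - 1\<close> boxes is a walk of \<open>a - 2\<close>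
    steps.\<close>
  then obtain n where a: "a = Suc (Suc n)"
    using less_iff_Suc_add[of 1 a] by auto
  have "border_strip as = walk (0, 0) (replicate n Up)"
    using walk_replicate_Up[of 0 0 n] by (simp add: border_strip_def as a)
  moreover have "strip_blocks as = replicate n Up @ [end_step as]"
    by (simp add: strip_blocks_def end_step_def as a replicate_append_same)
  ultimately show ?thesis by (rule that)
next
  case False
  then obtain bs b where as: "as = bs @ [b]" and bs: "bs \<noteq> []"
    using assms(1) by (cases as rule: rev_cases) auto
  obtain n where b: "b = Suc n"
    using assms(2) as by (cases b) auto
  have "strip_steps as = strip_blocks bs @ replicate n (end_step as)"
    using bs by (auto simp: strip_steps_def strip_blocks_def end_step_def as b nth_append
        intro!: arg_cong[of _ _ concat])
  then have "strip_blocks as = strip_steps as @ [end_step as]"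
    using bs by (simp add: as strip_blocks_snoc b replicate_append_same)
  moreover have "border_strip as = walk (0, 0) (strip_steps as)"
    using False by (simp add: border_strip_def)
  ultimately show ?thesis using that by blast
qed

lemma transfer_end_vec: "transfer q m (end_step as) (end_vec m as) = box_vec q m"
  using transfer_Up_delta[of q m] transfer_Rgt_delta[of q m]
  by (simp add: end_step_def end_vec_def[abs_def])

lemma Omega_border_strip:
  assumes "as \<noteq> []" "\<forall>a\<in>set as. a > 0" "i \<le> m"
  shows "Omega m (m + 1 - i) 1 (border_strip as) = (\<Sum>k\<le>i. strip_vec m as k)"
proof (cases "as = [1]")
  case True
  have "(\<Sum>k\<le>i. of_bool (k = 0)) = (1 :: rat poly)"
    by (simp add: of_bool_def)
  then show ?thesis
    by (simp add: True Omega_def border_strip_def P_partitions_def strip_vec_def strip_blocks_def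
        end_vec_def monom_0)
next
  case False
  obtain ss where "border_strip as = walk (0, 0) ss" "strip_blocks as = ss @ [end_step as]"
    using border_strip_walk[OF assms(1,2) False] .
  then show ?thesis
    using Omega_walk[OF assms(3)] by (simp add: strip_vec_def transfer_end_vec)
qed

lemma coeff_0_strip_vec:
  assumes "as \<noteq> []" "\<forall>a\<in>set as. a > 0"
  shows "coeff (strip_vec m as 0) 0 = 1"
proof (cases "as = [1]")
  case True
  then show ?thesis
    by (simp add: strip_vec_def strip_blocks_def end_vec_def)
next
  case False
  obtain ss where "strip_blocks as = ss @ [end_step as]"
    using border_strip_walk[OF assms False] .
  then show ?thesis
    by (simp add: strip_vec_def transfer_end_vec coeff_0_transfers_box_vec)
qed

lemma ratfun_fps_higher_q_rat:
  assumes "is_cfrac as x" "i \<le> m"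
  shows "ratfun_fps (higher_q_rat i m x)
    = fps_of_poly (\<Sum>k\<le>i. strip_vec m as k) / fps_of_poly (strip_vec m as 0)"
proof -
  have as: "as \<noteq> []" "\<forall>a\<in>set as. a > 0"
    using assms(1) by (auto simp: is_cfrac_def)
  show ?thesis
    using Omega_border_strip[OF as assms(2)] Omega_border_strip[OF as, of 0] coeff_0_strip_vec[OF as]
    by (simp add: higher_q_rat_def strip_of_eq[OF assms(1)] ratfun_fps_Fract)
qed

section \<open>Consecutive convergents\<close>

text \<open>With invertible denominators the difference is
  \<open>(p * q' - q * p') / (q * q')\<close>, so it inherits the factor
  \<open>monom 1 n\<close>.\<close>

lemma fps_divide_diff_nth_eq_0:
  fixes p q p' q' :: "'a::field poly"
  assumes "coeff q 0 \<noteq> 0" "coeff q' 0 \<noteq> 0" "monom 1 n dvd p * q' - q * p'" "k < n"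
  shows "fps_nth (fps_of_poly p / fps_of_poly q - fps_of_poly p' / fps_of_poly q') k = 0"
proof -
  let ?P = "fps_of_poly p" and ?Q = "fps_of_poly q" and ?P' = "fps_of_poly p'" and ?Q' = "fps_of_poly q'"
  have inv: "?Q * inverse ?Q = 1" "?Q' * inverse ?Q' = 1"
    using assms(1,2) by (simp_all add: inverse_mult_eq_1')
  obtain r where r: "p * q' - q * p' = monom 1 n * r"
    using assms(3) by (auto elim: dvdE)
  have "?P / ?Q - ?P' / ?Q' = ?P * inverse ?Q - ?P' * inverse ?Q'"
    using assms(1,2) by (simp add: fps_divide_unit)
  also have "\<dots> = ?P * inverse ?Q * (?Q' * inverse ?Q') - ?P' * inverse ?Q' * (?Q * inverse ?Q)"
    by (simp add: inv)
  also have "\<dots> = (?P * ?Q' - ?Q * ?P') * (inverse ?Q * inverse ?Q')"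
    by (simp add: algebra_simps)
  also have "?P * ?Q' - ?Q * ?P' = fps_X ^ n * fps_of_poly r"
    using arg_cong[OF r, of fps_of_poly]
    by (simp add: fps_of_poly_mult fps_of_poly_diff fps_of_poly_monom')
  finally have "?P / ?Q - ?P' / ?Q' = fps_X ^ n * (fps_of_poly r * (inverse ?Q * inverse ?Q'))"
    by (simp only: mult.assoc)
  then show ?thesis
    using assms(4) by (simp add: fps_X_power_mult_nth)
qed

text \<open>The cross difference is a sum of minors with one index in \<open>{..i}\<close> and the
  other 0. Each common step in \<open>ss\<close> contributes a factor \<open>q\<close>, whatever the
  end vectors \<open>u\<close> and \<open>v\<close> are.\<close>

lemma convergents_agree:
  assumes "i \<le> m" "is_cfrac as x" "is_cfrac bs y"
    and "strip_vec m as = transfers (monom 1 1) m ss u" "strip_vec m bs = transfers (monom 1 1) m ss v"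
    and "k < length ss"
  shows "fps_nth (ratfun_fps (higher_q_rat i m y) - ratfun_fps (higher_q_rat i m x)) k = 0"
proof -
  let ?a = "strip_vec m as" and ?b = "strip_vec m bs"
  have "monom 1 1 ^ length ss dvd sum ?b {..i} * sum ?a {0} - sum ?b {0} * sum ?a {..i}"
    unfolding assms(4,5) using assms(1) by (intro minor_sum_dvd minor_transfers_dvd) auto
  then show ?thesis
    unfolding ratfun_fps_higher_q_rat[OF assms(2,1)] ratfun_fps_higher_q_rat[OF assms(3,1)]
    using assms(2,3,6)
    by (intro fps_divide_diff_nth_eq_0) (auto simp: coeff_0_strip_vec is_cfrac_def monom_power)
qed

text \<open>The appended block goes right and fixes the end vector at 0, so the shorter strip can be
  given all steps of the longer one.\<close>

lemma strip_vec_snoc_even: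
  assumes "as \<noteq> []" "odd (length as)"
  shows "strip_vec m as = transfers (monom 1 1) m (strip_blocks (as @ [b])) (end_vec m as)"
  using assms
  by (simp add: strip_vec_def strip_blocks_snoc end_step_def end_vec_def[abs_def]
      transfers_replicate_Rgt_fixed del: foldr_replicate)

text \<open>In general the last block is absorbed into the end vector, and only the steps of the
  shorter strip are shared.\<close>

lemma strip_vec_snoc:
  assumes "as \<noteq> []"
  shows "strip_vec m (as @ [b]) = transfers (monom 1 1) m (strip_blocks as)
    (transfers (monom 1 1) m (replicate b (end_step (as @ [b]))) (end_vec m (as @ [b])))"
  using assms by (simp add: strip_vec_def strip_blocks_snoc)

theorem theoremB:
  fixes m i :: nat and x :: real and a :: "nat \<Rightarrow> nat"
  assumes "m \<ge> 1" and "i \<le> m"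
    and "x \<notin> \<rat>"
    and "\<And>k. k \<ge> 1 \<Longrightarrow> a k > 0"
    and "(\<lambda>n. of_rat (cfrac_convergent a n) :: real) \<longlonglongrightarrow> x"
  shows "(\<forall>n\<ge>2. even n \<longrightarrow>
            (\<forall>k. k < (\<Sum>j=1..n. a j) - 1 \<longrightarrow>
               fps_nth (ratfun_fps (higher_q_rat i m (cfrac_convergent a n))
                        - ratfun_fps (higher_q_rat i m (cfrac_convergent a (n - 1)))) k = 0))
       \<and> (\<forall>n\<ge>2. odd n \<longrightarrow>
            (\<forall>k. k < (\<Sum>j=1..n-1. a j) - 1 \<longrightarrow>
               fps_nth (ratfun_fps (higher_q_rat i m (cfrac_convergent a n))
                        - ratfun_fps (higher_q_rat i m (cfrac_convergent a (n - 1)))) k = 0))"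
proof -
  define as where "as n = map a [1..<n + 1]" for n
  have cf: "is_cfrac (as n) (cfrac_convergent a n)" if "n \<ge> 1" for n
    using that assms(4) by (auto simp: is_cfrac_def as_def cfrac_convergent_def)
  have snoc: "as n = as (n - 1) @ [a n]" if "n \<ge> 2" for n
    using that by (cases n) (auto simp: as_def)
  have ne: "as n \<noteq> []" if "n \<ge> 1" for n
    using that by (auto simp: as_def)
  have len: "length (strip_blocks (as n)) = (\<Sum>j=1..n. a j) - 1" if "n \<ge> 1" for n
  proof -
    have "sum_list (as n) = (\<Sum>j=1..n. a j)"
      unfolding as_def interv_sum_list_conv_sum_set_nat
      by (simp only: set_upt Suc_eq_plus1[symmetric] atLeastLessThanSuc_atLeastAtMost)
    then show ?thesis
      using length_strip_blocks[of "as n"] cf[OF that] by (simp add: is_cfrac_def)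
  qed
  show ?thesis
  proof (intro conjI allI impI)
    fix n k assume n: "2 \<le> n" "even n" and k: "k < (\<Sum>j=1..n. a j) - 1"
    \<comment> \<open>The end vector of the shorter strip is then concentrated at 0, and the common
      steps are all of \<open>strip_blocks (as n)\<close>.\<close>
    have "odd (length (as (n - 1)))"
      using n by (simp add: as_def)
    then have "strip_vec m (as (n - 1))
        = transfers (monom 1 1) m (strip_blocks (as n)) (end_vec m (as (n - 1)))"
      using strip_vec_snoc_even[of "as (n - 1)" m "a n"] n by (simp add: snoc ne)
    then show "fps_nth (ratfun_fps (higher_q_rat i m (cfrac_convergent a n))
        - ratfun_fps (higher_q_rat i m (cfrac_convergent a (n - 1)))) k = 0"
      using n k by (intro convergents_agree[OF assms(2) cf cf _ strip_vec_def]) (auto simp: len)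
  next
    fix n k assume n: "2 \<le> n" "odd n" and k: "k < (\<Sum>j=1..n-1. a j) - 1"
    show "fps_nth (ratfun_fps (higher_q_rat i m (cfrac_convergent a n))
        - ratfun_fps (higher_q_rat i m (cfrac_convergent a (n - 1)))) k = 0"
    proof (rule convergents_agree[OF assms(2) cf cf strip_vec_def])
      \<comment> \<open>The last block now goes up, and the shorter strip ends at value
        \<open>m\<close>; the common steps are those of \<open>as (n - 1)\<close>, whence the
        smaller bound.\<close>
      show "strip_vec m (as n) = transfers (monom 1 1) m (strip_blocks (as (n - 1)))
          (transfers (monom 1 1) m (replicate (a n) (end_step (as n))) (end_vec m (as n)))"
        using strip_vec_snoc[of "as (n - 1)" m "a n"] n by (simp add: snoc[OF n(1)] ne)
    qed (use n k in \<open>auto simp: len\<close>)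
  qed
qed

end
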